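(* Let $p\ge 5$ be a prime and $n$ a positive integer. Then $a_1(pn)\equiv 0\pmod{p^2}$, where $$a_1(N)=\sum_{k=0}^{\lfloor (N-1)/3\rfloor}(-1)^{N-k}\binom{3k+1}{k}\binom{2k+1}{k}\binom{N}{3k+1}\binom{N+k}{k}3^{N-3k-1}.$$ *)

theory Defs
  imports "HOL-Number_Theory.Number_Theory"
begin

(* For N \<ge> 1 every natural-number subtraction below is exact, since k \<le> (N - 1) div 3
   gives 3 * k + 1 \<le> N.  At N = 0 the only summand (k = 0) contains the factor 0 choose 1 = 0,
   which agrees with the empty sum up to floor(-1/3) = -1. *)
definition a1 :: "nat \<Rightarrow> int" where
  "a1 N = (\<Sum>k = 0..(N - 1) div 3.
     (-1) ^ (N - k) * int ((3 * k + 1) choose k) * int ((2 * k + 1) choose k)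
       * int (N choose (3 * k + 1)) * int ((N + k) choose k) * 3 ^ (N - 3 * k - 1))"

end

theory Submission
  imports Defs
begin

text \<open>
  With \<open>c k = (3k)! / (k!\<^sup>2 (k+1)!)\<close>, an integer, the absorption identities give \<open>a1 N = N b(N)\<close>
  for an integer \<open>b(N)\<close>, so it remains to see that \<open>p\<close> divides \<open>b(pn)\<close>.  Splitting \<open>k = pq + r\<close>
  and applying Lucas' theorem, \<open>b(pn)\<close> factors modulo \<open>p\<close> over each block \<open>q\<close>, the inner factor
  being the sum of \<open>c r 27^(m-r)\<close> over \<open>r \<le> m = (p-1) div 3\<close>.  This sum telescopes to
  \<open>(3m+1)(3m+2) c m / 2\<close>, and \<open>p\<close> is \<open>3m+1\<close> or \<open>3m+2\<close>.
\<close>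

section \<open>Binomial coefficients modulo a prime\<close>

text \<open>Induction on the upper entry with Pascal's rule. Lowering an entry by one either lowers
  its last base-\<open>p\<close> digit or, if that digit is 0, borrows from the leading part; this
  gives four cases according to whether \<open>r\<close> and \<open>s\<close> vanish.\<close>

theorem choose_lucas:
  fixes p :: nat
  assumes p: "prime p" and "r < p" "s < p"
  shows "[(p * a + r) choose (p * b + s) = (a choose b) * (r choose s)] (mod p)"
  using assms(2,3)
proof (induction "p * a + r" arbitrary: a r b s)
  case 0
  then have "a = 0" "r = 0" using p by (auto simp: prime_gt_0_nat)
  moreover have "p > 0" using p by (simp add: prime_gt_0_nat)
  ultimately show ?case by (cases "b = 0 \<and> s = 0") (auto simp: binomial_eq_0)
next
  case (Suc x)
  have p0: "p > 1" using p by (rule prime_gt_1_nat)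
  show ?case
  proof (cases r)
    case r: (Suc r')
    have x: "x = p * a + r'" using Suc.hyps(2) r by simp
    have r': "r' < p" using Suc.prems r by simp
    note IH = Suc.hyps(1)[OF x r', folded x]
    show ?thesis
    proof (cases s)
      case (Suc s')
      have "(p * a + r) choose (p * b + s) = (x choose (p * b + s')) + (x choose (p * b + s))"
        using r Suc x by simp
      moreover have "[\<dots> = (a choose b) * (r' choose s') + (a choose b) * (r' choose s)] (mod p)"
        using Suc Suc.prems by (intro cong_add IH) auto
      ultimately show ?thesis using r Suc by (simp add: algebra_simps)
    next
      case s: 0
      show ?thesis
      proof (cases b)
        case 0
        then show ?thesis using s by simp
      next
        case (Suc b')
        \<comment> \<open>Only the lower entry borrows: its new last digit \<open>p - 1\<close>
          exceeds \<open>r'\<close>, so that Pascal summand vanishes modulo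
          \<open>p\<close>.\<close>
        have e: "p * b + s = Suc (p * b' + (p - 1))" using Suc s p0 by simp
        have "(p * a + r) choose (p * b + s)
              = (x choose (p * b' + (p - 1))) + (x choose (p * b + 0))"
          unfolding e using r x e s by simp
        moreover have "[\<dots> = (a choose b') * (r' choose (p - 1)) + (a choose b) * (r' choose 0)] (mod p)"
          using p0 by (intro cong_add IH) auto
        moreover have "r' choose (p - 1) = 0" using r Suc.prems by (simp add: binomial_eq_0)
        ultimately show ?thesis using s by (simp add: binomial_eq_0)
      qed
    qed
  next
    case r: 0
    then obtain a' where a: "a = Suc a'" using Suc.hyps(2) by (cases a) auto
    have x: "x = p * a' + (p - 1)" using Suc.hyps(2) r a p0 by simp
    have pr: "p - 1 < p" using p0 by simp
    note IH = Suc.hyps(1)[OF x pr, folded x]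
    have top: "p * a + r = Suc x" using Suc.hyps(2) by simp
    show ?thesis
    proof (cases s)
      case (Suc s')
      have "(p * a + r) choose (p * b + s) = (x choose (p * b + s')) + (x choose (p * b + s))"
        unfolding top using Suc by simp
      moreover have "[\<dots> = (a' choose b) * ((p - 1) choose s') + (a' choose b) * ((p - 1) choose s)] (mod p)"
        using Suc Suc.prems by (intro cong_add IH) auto
      \<comment> \<open>Only the upper entry borrows: its last digit is now \<open>p - 1\<close> in
        both summands, which recombine by Pascal into row \<open>p\<close>, where \<open>p\<close>
        divides every inner entry.\<close>
      moreover have "(a' choose b) * ((p - 1) choose s') + (a' choose b) * ((p - 1) choose s)
                     = (a' choose b) * (p choose s)"
        using choose_reduce_nat[of p s] p0 Suc by (simp add: algebra_simps)
      moreover have "p dvd (p choose s)"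
        using p Suc Suc.prems by (intro dvd_choose_prime) auto
      then have "[(a' choose b) * (p choose s) = 0] (mod p)"
        by (simp add: cong_0_iff)
      ultimately show ?thesis using r Suc by (auto intro: cong_trans)
    next
      case s: 0
      show ?thesis
      proof (cases b)
        case 0
        then show ?thesis using s by simp
      next
        case (Suc b')
        \<comment> \<open>Both entries borrow, so the last-digit binomials are 1 and Pascal's rule
          acts on the leading parts.\<close>
        have e: "p * b + s = Suc (p * b' + (p - 1))" using Suc s p0 by simp
        have "(p * a + r) choose (p * b + s)
              = (x choose (p * b' + (p - 1))) + (x choose (p * b + 0))"
          unfolding top e using e s by simp
        moreover have "[\<dots> = (a' choose b') * ((p - 1) choose (p - 1)) + (a' choose b) * ((p - 1) choose 0)] (mod p)"
          using p0 by (intro cong_add IH) auto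
        ultimately show ?thesis using s r a Suc by simp
      qed
    qed
  qed
qed

corollary choose_lucas_int:
  fixes p :: nat
  assumes "prime p" "r < p" "s < p"
  shows "[int ((p * a + r) choose (p * b + s)) = int (a choose b) * int (r choose s)] (mod int p)"
  using choose_lucas[OF assms, of a b] by (metis cong_int_iff of_nat_mult)

text \<open>Neighbouring entries of row \<open>p - 1\<close> add up to an inner entry of row
  \<open>p\<close>, hence are negatives of each other modulo \<open>p\<close>.\<close>

lemma choose_prime_minus_one_cong:
  fixes p :: nat
  assumes "prime p" "j < p"
  shows "[int ((p - 1) choose j) = (-1) ^ j] (mod int p)"
  using assms(2)
proof (induction j)
  case (Suc j)
  have "int (p choose Suc j) = int ((p - 1) choose j) + int ((p - 1) choose Suc j)"
    using Suc.prems choose_reduce_nat[of p "Suc j"] by simp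
  moreover have "int p dvd int (p choose Suc j)"
    using assms(1) Suc.prems by (intro of_nat_dvd_iff[THEN iffD2] dvd_choose_prime) auto
  ultimately have "[int ((p - 1) choose j) + int ((p - 1) choose Suc j) = 0] (mod int p)"
    by (simp add: cong_0_iff)
  from cong_diff[OF this Suc.IH] Suc.prems show ?case by simp
qed simp

section \<open>The integers (3k)! / (k!^2 (k+1)!)\<close>

text \<open>The second factor is the Catalan number, written as a difference of binomials so that
  integrality needs no division.\<close>

definition trinom_cat :: "nat \<Rightarrow> int" where
  "trinom_cat k = int ((3 * k) choose k) * (int ((2 * k) choose k) - int ((2 * k) choose Suc k))"

text \<open>Clearing the denominator of the Catalan number leaves a product of binomials, the form
  to which Lucas' theorem applies.\<close>

lemma Suc_times_trinom_cat:
  "int (Suc k) * trinom_cat k = int ((3 * k) choose k) * int ((2 * k) choose k)"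
proof -
  have "Suc k * ((2 * k) choose Suc k) = k * ((2 * k) choose k)"
    using binomial_absorb_comp[of "2 * k" k] binomial_absorption[of k "2 * k"]
    by auto
  then have "int (Suc k) * int ((2 * k) choose Suc k) = int k * int ((2 * k) choose k)"
    by (metis of_nat_mult)
  then have "int (Suc k) * (int ((2 * k) choose k) - int ((2 * k) choose Suc k)) = int ((2 * k) choose k)"
    by (simp add: algebra_simps)
  then show ?thesis unfolding trinom_cat_def by (metis mult.left_commute)
qed

lemma trinom_cat_fact: "trinom_cat k * (fact k * fact k * fact (Suc k)) = fact (3 * k)"
proof -
  have 1: "fact k * fact k * int ((2 * k) choose k) = fact (2 * k)"
    using binomial_fact_lemma[of k "2 * k"]
    by (metis add_diff_cancel_right' le_add2 mult_2 of_nat_fact of_nat_mult)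
  have "3 * k - k = 2 * k" by simp
  then have "fact k * fact (2 * k) * ((3 * k) choose k) = fact (3 * k)"
    using binomial_fact_lemma[of k "3 * k"] by simp
  then have 2: "fact k * fact (2 * k) * int ((3 * k) choose k) = fact (3 * k)"
    by (metis of_nat_fact of_nat_mult)
  have "trinom_cat k * (fact k * fact k * fact (Suc k))
        = (int (Suc k) * trinom_cat k) * (fact k * fact k * fact k)"
    by simp
  also have "\<dots> = fact k * (fact k * fact k * int ((2 * k) choose k)) * int ((3 * k) choose k)"
    unfolding Suc_times_trinom_cat by (simp only: ac_simps)
  finally show ?thesis using 1 2 by simp
qed

text \<open>Multiplied by k!^2 (k+1)!, both sides become (3k+1)!. The factor
  \<open>3 * k + 1\<close> is what lets \<open>N choose (3 * k + 1)\<close> release a factor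
  \<open>N\<close> later.\<close>

lemma trinom_cat_eq_choose:
  "int ((3 * k + 1) choose k) * int ((2 * k + 1) choose k) = int (3 * k + 1) * trinom_cat k"
proof -
  have "fact k * fact (Suc k) * ((2 * k + 1) choose k) = fact (2 * k + 1)"
    using binomial_fact_lemma[of k "2 * k + 1"] by (simp add: Suc_diff_le mult_2)
  then have 1: "fact k * fact (Suc k) * int ((2 * k + 1) choose k) = fact (2 * k + 1)"
    by (metis of_nat_fact of_nat_mult)
  have "3 * k + 1 - k = 2 * k + 1" by simp
  then have "fact k * fact (2 * k + 1) * ((3 * k + 1) choose k) = fact (3 * k + 1)"
    using binomial_fact_lemma[of k "3 * k + 1"] by simp
  then have 2: "fact k * fact (2 * k + 1) * int ((3 * k + 1) choose k) = fact (3 * k + 1)"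
    by (metis of_nat_fact of_nat_mult)
  let ?F = "fact k * fact k * fact (Suc k) :: int"
  have "int ((3 * k + 1) choose k) * int ((2 * k + 1) choose k) * ?F
        = fact k * (fact k * fact (Suc k) * int ((2 * k + 1) choose k)) * int ((3 * k + 1) choose k)"
    by (simp only: ac_simps)
  also have "\<dots> = fact (3 * k + 1)" unfolding 1 by (rule 2)
  also have "\<dots> = int (3 * k + 1) * trinom_cat k * ?F"
    using trinom_cat_fact[of k] by (simp add: mult.assoc del: fact_Suc) simp
  finally show ?thesis by simp
qed

lemma trinom_cat_rec:
  "int ((k + 1) * (k + 2)) * trinom_cat (Suc k) = 3 * int ((3 * k + 1) * (3 * k + 2)) * trinom_cat k"
proof -
  let ?F = "fact k * fact k * fact (Suc k) :: int"
  \<comment> \<open>The extra \<open>k + 1\<close> completes the factorials; it cancels against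
    \<open>3 * k + 3\<close>, leaving the coefficient 3.\<close>
  have "int (k + 1) * (int ((k + 1) * (k + 2)) * trinom_cat (Suc k)) * ?F
        = trinom_cat (Suc k) * (fact (Suc k) * fact (Suc k) * fact (Suc (Suc k)))"
    by (simp add: algebra_simps)
  also have "\<dots> = fact (Suc (Suc (Suc (3 * k))))" 
    unfolding trinom_cat_fact by (simp only: mult_Suc_right) (simp add: numeral_3_eq_3)
  also have "\<dots> = int (3 * k + 3) * int ((3 * k + 1) * (3 * k + 2)) * fact (3 * k)"
    by (simp add: algebra_simps)
  also have "\<dots> = int (k + 1) * (3 * int ((3 * k + 1) * (3 * k + 2)) * trinom_cat k) * ?F"
    unfolding trinom_cat_fact[of k, symmetric] by (simp add: algebra_simps)
  finally show ?thesis by simp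
qed

section \<open>The weighted sum over one block\<close>

lemma sum_trinom_cat:
  "2 * (\<Sum>r\<le>m. trinom_cat r * 27 ^ (m - r)) = int ((3 * m + 1) * (3 * m + 2)) * trinom_cat m"
proof (induction m)
  case 0
  then show ?case by (simp add: trinom_cat_def)
next
  case (Suc m)
  have "(\<Sum>r\<le>m. trinom_cat r * 27 ^ (Suc m - r)) = 27 * (\<Sum>r\<le>m. trinom_cat r * 27 ^ (m - r))"
    unfolding sum_distrib_left by (rule sum.cong) (auto simp: Suc_diff_le)
  then have "2 * (\<Sum>r\<le>Suc m. trinom_cat r * 27 ^ (Suc m - r))
      = 27 * (2 * (\<Sum>r\<le>m. trinom_cat r * 27 ^ (m - r))) + 2 * trinom_cat (Suc m)"
    by simp
  \<comment> \<open>Splitting 27 as 9 * 3 exposes the recurrence; then 9(m+1)(m+2) + 2 =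
    (3m+4)(3m+5) closes the induction.\<close>
  also have "\<dots> = 9 * (3 * int ((3 * m + 1) * (3 * m + 2)) * trinom_cat m) + 2 * trinom_cat (Suc m)"
    unfolding Suc by simp
  also have "\<dots> = int ((3 * Suc m + 1) * (3 * Suc m + 2)) * trinom_cat (Suc m)"
    unfolding trinom_cat_rec[symmetric] by (simp add: algebra_simps)
  finally show ?case .
qed

lemma prime_dvd_sum_trinom_cat:
  fixes p :: nat
  assumes p: "prime p" "p \<ge> 5"
  shows "int p dvd (\<Sum>r\<le>(p - 1) div 3. trinom_cat r * 27 ^ ((p - 1) div 3 - r))"
proof -
  define m where "m = (p - 1) div 3"
  have "\<not> 3 dvd p" using p primes_dvd_imp_eq[of 3 p] by auto
  then have "p = 3 * m + 1 \<or> p = 3 * m + 2" unfolding m_def using p by presburger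
  then have "p dvd (3 * m + 1) * (3 * m + 2)" by (elim disjE) (simp_all only: dvd_triv_left dvd_triv_right)
  then have "int p dvd 2 * (\<Sum>r\<le>m. trinom_cat r * 27 ^ (m - r))"
    unfolding sum_trinom_cat by (intro dvd_mult2) (simp only: of_nat_dvd_iff)
  moreover have "coprime (int p) 2"
    using p prime_odd_nat[of p] by (simp add: coprime_right_2_iff_odd)
  ultimately show ?thesis unfolding m_def using coprime_dvd_mult_right_iff by blast
qed

section \<open>Residues of \<open>trinom_cat\<close> at \<open>p * q + r\<close>\<close>

text \<open>Since \<open>3 * r < p\<close>, tripling and doubling \<open>p * q + r\<close> cause no
  carry, so Lucas splits both binomials. The index plus one is congruent to \<open>Suc r\<close>,
  which is invertible modulo \<open>p\<close> and cancels; hence plain binomials in \<open>q\<close>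
  remain rather than \<open>trinom_cat q\<close>.\<close>

lemma trinom_cat_cong:
  fixes p :: nat
  assumes p: "prime p" "3 * r < p"
  shows "[trinom_cat (p * q + r)
          = int ((3 * q) choose q) * int ((2 * q) choose q) * trinom_cat r] (mod int p)"
proof -
  let ?k = "p * q + r"
  have 3: "[int ((3 * ?k) choose ?k) = int ((3 * q) choose q) * int ((3 * r) choose r)] (mod int p)"
    using choose_lucas_int[of p "3 * r" r "3 * q" q] p by (simp add: algebra_simps)
  have 2: "[int ((2 * ?k) choose ?k) = int ((2 * q) choose q) * int ((2 * r) choose r)] (mod int p)"
    using choose_lucas_int[of p "2 * r" r "2 * q" q] p by (simp add: algebra_simps)
  have "[int (Suc ?k) * trinom_cat ?k = int ((3 * q) choose q) * int ((3 * r) choose r)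
           * (int ((2 * q) choose q) * int ((2 * r) choose r))] (mod int p)"
    unfolding Suc_times_trinom_cat by (intro cong_mult 3 2)
  also have "int ((3 * q) choose q) * int ((3 * r) choose r)
               * (int ((2 * q) choose q) * int ((2 * r) choose r))
             = int ((3 * q) choose q) * int ((2 * q) choose q) * (int (Suc r) * trinom_cat r)"
    unfolding Suc_times_trinom_cat by (simp only: ac_simps)
  also have "\<dots> = int (Suc r) * (int ((3 * q) choose q) * int ((2 * q) choose q) * trinom_cat r)"
    by (simp only: ac_simps)
  finally have *: "[int (Suc ?k) * trinom_cat ?k = \<dots>] (mod int p)" .
  have "[int (Suc r) = int (Suc ?k)] (mod int p)"
    by (simp add: cong_iff_dvd_diff)
  then have "[int (Suc r) * trinom_cat ?k = int (Suc ?k) * trinom_cat ?k] (mod int p)"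
    by (intro cong_mult cong_refl)
  from cong_trans[OF this *]
  have "[int (Suc r) * trinom_cat ?k
         = int (Suc r) * (int ((3 * q) choose q) * int ((2 * q) choose q) * trinom_cat r)] (mod int p)" .
  moreover have "coprime (Suc r) p"
    using p by (cases "r = 0") (auto intro!: prime_imp_coprime_nat[THEN coprime_commute[THEN iffD1]] dest: dvd_imp_le)
  then have "coprime (int (Suc r)) (int p)" by (simp only: coprime_int_iff)
  ultimately show ?thesis using cong_mult_lcancel by blast
qed

text \<open>Adding three copies of \<open>r\<close> carries in base \<open>p\<close>, so some
  last-digit binomial has its lower entry above its upper one. The case \<open>r = p - 1\<close>
  stands apart because there \<open>p\<close> divides the index plus one, which then cannot be
  cancelled.\<close>

lemma trinom_cat_cong_0:
  fixes p :: nat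
  assumes p: "prime p" "p \<ge> 5" and r: "r < p" "p \<le> 3 * r"
  shows "[trinom_cat (p * q + r) = 0] (mod int p)"
proof (cases "r = p - 1")
  case True
  have "3 * (p * q + r) = p * (3 * q + 2) + (p - 3)" using True p by (simp add: algebra_simps)
  then have "[int ((3 * (p * q + r)) choose (p * q + r))
              = int ((3 * q + 2) choose q) * int ((p - 3) choose r)] (mod int p)"
    using choose_lucas_int[of p "p - 3" r "3 * q + 2" q] p r by simp
  moreover have "(p - 3) choose r = 0" using True p by (simp add: binomial_eq_0)
  ultimately show ?thesis unfolding trinom_cat_def by (auto simp: cong_0_iff)
next
  case False
  let ?k = "p * q + r"
  have "[int ((3 * ?k) choose ?k) * int ((2 * ?k) choose ?k) = 0] (mod int p)"
  \<comment> \<open>The first carry decides which binomial vanishes: if doubling does not carry,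
    tripling leaves the digit \<open>3 * r - p < r\<close>; otherwise doubling leaves
    \<open>2 * r - p < r\<close>.\<close>
  proof (cases "2 * r < p")
    case True
    have "3 * ?k = p * (3 * q + 1) + (3 * r - p)" using r by (simp add: algebra_simps)
    then have "[int ((3 * ?k) choose ?k) = int ((3 * q + 1) choose q) * int ((3 * r - p) choose r)] (mod int p)"
      by (simp only:) (rule choose_lucas_int, use p r True in auto)
    moreover have "(3 * r - p) choose r = 0" using True r by (simp add: binomial_eq_0)
    ultimately show ?thesis by (auto simp: cong_0_iff)
  next
    case False
    have "2 * ?k = p * (2 * q + 1) + (2 * r - p)" using False by (simp add: algebra_simps)
    then have "[int ((2 * ?k) choose ?k) = int ((2 * q + 1) choose q) * int ((2 * r - p) choose r)] (mod int p)"
      by (simp only:) (rule choose_lucas_int, use p r False in auto)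
    moreover have "(2 * r - p) choose r = 0" using False r by (simp add: binomial_eq_0)
    ultimately show ?thesis by (auto simp: cong_0_iff)
  qed
  then have "int p dvd int (Suc ?k) * trinom_cat ?k"
    unfolding Suc_times_trinom_cat by (simp add: cong_0_iff)
  moreover have "\<not> p dvd Suc r"
    using False r by (intro nat_dvd_not_less) auto
  then have "\<not> p dvd Suc ?k"
    by (metis add_Suc_right dvd_add_right_iff dvd_triv_left)
  then have "\<not> int p dvd int (Suc ?k)" unfolding of_nat_dvd_iff .
  ultimately show ?thesis
    using p by (metis cong_0_iff prime_dvd_mult_iff prime_nat_int_transfer)
qed

section \<open>Extracting the factor \<open>N\<close>\<close>

text \<open>The summand of \<open>a1 N\<close> divided by \<open>N\<close>. The sign exponent
  \<open>N + k\<close> has the parity of \<open>N - k\<close> and avoids truncated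
  subtraction.\<close>

definition a1_term :: "nat \<Rightarrow> nat \<Rightarrow> int" where
  "a1_term N k = (-1) ^ (N + k) * int ((N - 1) choose (3 * k)) * trinom_cat k
     * int ((N + k) choose k) * 3 ^ (N - 1 - 3 * k)"

lemma a1_eq:
  assumes "N > 0"
  shows "a1 N = int N * (\<Sum>k<N. a1_term N k)"
proof -
  have "a1 N = (\<Sum>k = 0..(N - 1) div 3. int N * a1_term N k)"
    unfolding a1_def
  proof (rule sum.cong)
    fix k assume "k \<in> {0..(N - 1) div 3}"
    then have k: "3 * k + 1 \<le> N" using assms by auto
    have sgn: "(-1) ^ (N - k) = ((-1) ^ (N + k) :: int)"
      using k by (simp add: minus_one_power_iff)
    have "(3 * k + 1) * (N choose (3 * k + 1)) = N * ((N - 1) choose (3 * k))"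
      using binomial_absorption[of "3 * k" N] by simp
    then have ch: "int (3 * k + 1) * int (N choose (3 * k + 1)) = int N * int ((N - 1) choose (3 * k))"
      by (metis of_nat_mult)
    have "(-1) ^ (N - k) * int ((3 * k + 1) choose k) * int ((2 * k + 1) choose k)
            * int (N choose (3 * k + 1)) * int ((N + k) choose k) * 3 ^ (N - 3 * k - 1)
          = (-1) ^ (N + k) * (int ((3 * k + 1) choose k) * int ((2 * k + 1) choose k))
            * int (N choose (3 * k + 1)) * int ((N + k) choose k) * 3 ^ (N - 1 - 3 * k)"
      unfolding sgn by (simp add: mult.assoc)
    also have "\<dots> = (-1) ^ (N + k) * (int (3 * k + 1) * int (N choose (3 * k + 1))) * trinom_cat k
            * int ((N + k) choose k) * 3 ^ (N - 1 - 3 * k)"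
      unfolding trinom_cat_eq_choose by (simp only: ac_simps)
    also have "\<dots> = int N * a1_term N k"
      unfolding ch a1_term_def by (simp only: ac_simps)
    finally show "(-1) ^ (N - k) * int ((3 * k + 1) choose k) * int ((2 * k + 1) choose k)
            * int (N choose (3 * k + 1)) * int ((N + k) choose k) * 3 ^ (N - 3 * k - 1)
          = int N * a1_term N k" .
  qed simp
  \<comment> \<open>The added terms have \<open>3 * k > N - 1\<close> and vanish; for
    \<open>N = p * n\<close> the longer range consists of complete blocks of length
    \<open>p\<close>.\<close>
  also have "\<dots> = (\<Sum>k<N. int N * a1_term N k)"
    using assms by (intro sum.mono_neutral_left) (auto simp: a1_term_def binomial_eq_0)
  finally show ?thesis by (simp add: sum_distrib_left)
qed

section \<open>Block sums modulo \<open>p\<close>\<close>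

lemma a1_term_cong:
  fixes p n q r :: nat
  assumes p: "prime p" "p \<ge> 5" and q: "3 * q < n" and r: "3 * r < p"
  defines "m \<equiv> (p - 1) div 3"
  shows "[a1_term (p * n) (p * q + r)
          = (-1) ^ (p * n + p * q) * int ((n - 1) choose (3 * q)) * int ((3 * q) choose q)
            * int ((2 * q) choose q) * int ((n + q) choose q) * 3 ^ (p * (n - 1 - 3 * q) + (p - 1 - 3 * m))
            * (trinom_cat r * 27 ^ (m - r))] (mod int p)"
proof -
  let ?k = "p * q + r" and ?N = "p * n"
  obtain d where n: "n = Suc (3 * q + d)" using q less_iff_Suc_add by auto
  have rm: "r \<le> m" "3 * m < p" using r p unfolding m_def by auto
  \<comment> \<open>Only the last summand depends on \<open>r\<close>; it supplies the weight
    \<open>27 ^ (m - r)\<close>.\<close>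
  have exp: "?N - 1 - 3 * ?k = p * (n - 1 - 3 * q) + (p - 1 - 3 * m) + 3 * (m - r)"
  proof -
    have "?N = 3 * (p * q) + p * d + p" unfolding n by (simp add: algebra_simps)
    then show ?thesis unfolding n using rm by (simp add: algebra_simps)
  qed
  have "?N - 1 = p * (n - 1) + (p - 1)" unfolding n using p by (simp add: algebra_simps)
  then have "[int ((?N - 1) choose (3 * ?k)) = int ((n - 1) choose (3 * q)) * int ((p - 1) choose (3 * r))] (mod int p)"
    using choose_lucas_int[of p "p - 1" "3 * r" "n - 1" "3 * q"] p r by (simp add: algebra_simps)
  moreover have "[int ((n - 1) choose (3 * q)) * int ((p - 1) choose (3 * r))
                  = int ((n - 1) choose (3 * q)) * (-1) ^ (3 * r)] (mod int p)"
    by (intro cong_mult cong_refl choose_prime_minus_one_cong p r)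
  ultimately have 1: "[int ((?N - 1) choose (3 * ?k)) = int ((n - 1) choose (3 * q)) * (-1) ^ (3 * r)] (mod int p)"
    by (rule cong_trans)
  have 2: "[int ((?N + ?k) choose ?k) = int ((n + q) choose q)] (mod int p)"
    using choose_lucas_int[of p r r "n + q" q] p r by (simp add: algebra_simps)
  have "[a1_term ?N ?k = (-1) ^ (?N + ?k) * (int ((n - 1) choose (3 * q)) * (-1) ^ (3 * r))
          * (int ((3 * q) choose q) * int ((2 * q) choose q) * trinom_cat r)
          * int ((n + q) choose q) * 3 ^ (?N - 1 - 3 * ?k)] (mod int p)"
    unfolding a1_term_def by (intro cong_mult cong_refl 1 2 trinom_cat_cong p r)
  also have "(-1) ^ (?N + ?k) * (int ((n - 1) choose (3 * q)) * (-1) ^ (3 * r))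
          * (int ((3 * q) choose q) * int ((2 * q) choose q) * trinom_cat r)
          * int ((n + q) choose q) * 3 ^ (?N - 1 - 3 * ?k)
        = ((-1) ^ (?N + ?k) * (-1) ^ (3 * r)) * int ((n - 1) choose (3 * q)) * int ((3 * q) choose q)
            * int ((2 * q) choose q) * int ((n + q) choose q) * 3 ^ (p * (n - 1 - 3 * q) + (p - 1 - 3 * m))
            * (trinom_cat r * 3 ^ (3 * (m - r)))"
    unfolding exp power_add[of 3] by (simp only: ac_simps)
  \<comment> \<open>The \<open>r\<close> in \<open>?k\<close> and the \<open>3 * r\<close> from row
    \<open>p - 1\<close> sum to the even number \<open>4 * r\<close>, so the sign is constant on the
    block.\<close>
  also have "(-1) ^ (?N + ?k) * (-1) ^ (3 * r) = ((-1) ^ (p * n + p * q) :: int)"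
  proof -
    have "?N + ?k + 3 * r = (p * n + p * q) + 2 * (2 * r)" by simp
    then show ?thesis unfolding power_add[symmetric] by (simp only: power_add power_mult) simp
  qed
  also have "(3 :: int) ^ (3 * (m - r)) = 27 ^ (m - r)"
    by (simp add: power_mult)
  finally show ?thesis .
qed

text \<open>For \<open>3 * q < n\<close>, the terms with \<open>r > m\<close> vanish modulo
  \<open>p\<close> and the others share the factor \<open>G\<close>, leaving the weighted sum
  already known to be divisible by \<open>p\<close>. For \<open>3 * q \<ge> n\<close> every term is
  exactly zero.\<close>

lemma prime_dvd_sum_a1_term:
  fixes p n q :: nat
  assumes p: "prime p" "p \<ge> 5" and n: "n > 0"
  shows "int p dvd (\<Sum>r<p. a1_term (p * n) (p * q + r))"
proof (cases "3 * q < n")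
  case True
  define m where "m = (p - 1) div 3"
  define G where "G = (-1) ^ (p * n + p * q) * int ((n - 1) choose (3 * q)) * int ((3 * q) choose q)
            * int ((2 * q) choose q) * int ((n + q) choose q) * 3 ^ (p * (n - 1 - 3 * q) + (p - 1 - 3 * m))"
  have "[(\<Sum>r<p. a1_term (p * n) (p * q + r))
         = (\<Sum>r<p. if r \<le> m then G * (trinom_cat r * 27 ^ (m - r)) else 0)] (mod int p)"
  proof (rule cong_sum)
    fix r assume "r \<in> {..<p}"
    then have r: "r < p" by simp
    show "[a1_term (p * n) (p * q + r)
           = (if r \<le> m then G * (trinom_cat r * 27 ^ (m - r)) else 0)] (mod int p)"
    proof (cases "r \<le> m")
      case rm: True
      then have "3 * r < p" unfolding m_def using p by auto
      from a1_term_cong[OF p True this] rm show ?thesis unfolding m_def G_def by simp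
    next
      case False
      then have "p \<le> 3 * r" unfolding m_def by auto
      from trinom_cat_cong_0[OF p r this] False show ?thesis
        unfolding a1_term_def by (simp add: cong_0_iff)
    qed
  qed
  also have "(\<Sum>r<p. if r \<le> m then G * (trinom_cat r * 27 ^ (m - r)) else 0)
             = (\<Sum>r\<le>m. G * (trinom_cat r * 27 ^ (m - r)))"
    using p unfolding m_def by (intro sum.mono_neutral_cong_right) auto
  also have "\<dots> = G * (\<Sum>r\<le>m. trinom_cat r * 27 ^ (m - r))"
    by (simp add: sum_distrib_left)
  also have "[\<dots> = 0] (mod int p)"
    using prime_dvd_sum_trinom_cat[OF p] unfolding m_def by (simp add: cong_0_iff)
  finally show ?thesis by (simp add: cong_0_iff)
next
  case False
  have "a1_term (p * n) (p * q + r) = 0" for r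
  proof -
    have "p * n \<le> p * (3 * q)" using False by (intro mult_le_mono2) simp
    moreover have "p * n > 0" using p n by simp
    moreover have "3 * (p * q + r) = p * (3 * q) + 3 * r" by (simp add: algebra_simps)
    ultimately have "p * n - 1 < 3 * (p * q + r)" by linarith
    then show ?thesis unfolding a1_term_def by (simp add: binomial_eq_0)
  qed
  then show ?thesis by simp
qed

theorem theorem3p1:
  fixes p n :: nat
  assumes "prime p" and "p \<ge> 5" and "n > 0"
  shows "[a1 (p * n) = 0] (mod (int p)\<^sup>2)"
proof -
  have "(\<Sum>k<p * n. a1_term (p * n) k) = (\<Sum>q<n. sum (a1_term (p * n)) {q * p..<q * p + p})"
    by (simp add: sum.nat_group mult.commute)
  also have "\<dots> = (\<Sum>q<n. \<Sum>r<p. a1_term (p * n) (p * q + r))"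
  proof (rule sum.cong)
    fix q
    show "sum (a1_term (p * n)) {q * p..<q * p + p} = (\<Sum>r<p. a1_term (p * n) (p * q + r))"
      using sum.shift_bounds_nat_ivl[of "a1_term (p * n)" 0 "q * p" p]
      by (simp add: ac_simps lessThan_atLeast0)
  qed simp
  also have "int p dvd \<dots>"
    using assms by (intro dvd_sum prime_dvd_sum_a1_term) auto
  finally have "int p dvd (\<Sum>k<p * n. a1_term (p * n) k)" .
  \<comment> \<open>One \<open>p\<close> comes from the extracted factor \<open>p * n\<close>, the
    other from the sum.\<close>
  then have "int p * int p dvd int (p * n) * (\<Sum>k<p * n. a1_term (p * n) k)"
    by (intro mult_dvd_mono) auto
  moreover have "p * n > 0" using assms by simp
  ultimately show ?thesis by (simp add: a1_eq cong_0_iff power2_eq_square)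
qed

end
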